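(* Let $G$ be a group and $S=\{s_1,\dots,s_\ell\}\subseteq G$, and let $X=\mathrm{BiCay}(G,\emptyset,\emptyset,S)$. If $X$ has girth at least six, then $X$ is isomorphic to $\mathrm{BCay}(G,\pi)$ where $\pi=\{C_1,\dots,C_\ell\}$ with $C_i=\{s_i^{-1}s_j: 1\le j\le \ell\}$ for $1\le i\le\ell$ (and this $\pi$ satisfies the conditions making $\mathrm{BCay}(G,\pi)$ a Cayley incidence graph).
   Context: $\mathrm{BiCay}(G,\emptyset,\emptyset,S)$ is the graph with vertex set $G\times\{0,1\}$ and edges $\{(g,0),(gs,1)\}$ for $g\in G$, $s\in S$. For $C\subseteq G$ and $g\in G$, $gC=\{gs:s\in C\}$. A collection $\pi$ of subsets of $G$, each containing $e$, satisfies the $T$-axiom if for every $C\in\pi$ and $s\in C$, $s^{-1}C\in\pi$. For a collection $\pi$ of distinct subsets of $G$ of equal size containing $e$, pairwise intersecting exactly in $\{e\}$ and satisfying the $T$-axiom, the Cayley incidence graph $\mathrm{BCay}(G,\pi)$ is the bipartite graph with parts $\gamma=G$ and $\beta=\{gC:g\in G,C\in\pi\}$ (a set of subsets), with $g$ adjacent to $gC$ for every $g\in G$, $C\in\pi$. *)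

theory Defs
  imports "HOL-Algebra.Coset" "HOL-Library.Extended_Nat" "HOL-Library.Equipollence"
    "Graph_Theory.Graph_Theory"
begin

text \<open>
  An undirected simple graph is a loop-free symmetric \<^typ>\<open>'a pair_pre_digraph\<close>: an edge
  \<open>{u, v}\<close> is the pair of arcs \<open>(u, v)\<close>, \<open>(v, u)\<close>, which \<^const>\<open>mk_symmetric\<close> produces from either.
  Between such graphs \<^const>\<open>digraph_iso\<close> is ordinary graph isomorphism.
\<close>

text \<open>
  \<^const>\<open>pre_digraph.cycle\<close> also accepts going back and forth along one edge,
  \<open>[(u, v), (v, u)]\<close>; the bound 3 excludes these. An acyclic graph has girth \<open>\<infinity>\<close>.
\<close>
definition girth :: "'a pair_pre_digraph \<Rightarrow> enat" where
  "girth X = (INF p \<in> {p. pre_digraph.cycle (with_proj X) p \<and> 3 \<le> length p}. enat (length p))"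

text \<open>The graph \<open>BiCay(G, \<emptyset>, \<emptyset>, S)\<close>.\<close>
definition bicay :: "('a, 'm) monoid_scheme \<Rightarrow> 'a set \<Rightarrow> ('a \<times> nat) pair_pre_digraph" where
  "bicay G S = mk_symmetric
     \<lparr> pverts = carrier G \<times> {0, 1},
       parcs = {((g, 0), (g \<otimes>\<^bsub>G\<^esub> s, 1)) | g s. g \<in> carrier G \<and> s \<in> S} \<rparr>"

definition T_axiom :: "('a, 'm) monoid_scheme \<Rightarrow> 'a set set \<Rightarrow> bool" where
  "T_axiom G \<pi> \<longleftrightarrow> (\<forall>C\<in>\<pi>. \<forall>s\<in>C. inv\<^bsub>G\<^esub> s <#\<^bsub>G\<^esub> C \<in> \<pi>)"

text \<open>The conditions on \<open>\<pi>\<close> under which \<open>BCay(G, \<pi>)\<close> is called a Cayley incidence graph.\<close>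
definition cayley_incidence_family :: "('a, 'm) monoid_scheme \<Rightarrow> 'a set set \<Rightarrow> bool" where
  "cayley_incidence_family G \<pi> \<longleftrightarrow>
     (\<forall>C\<in>\<pi>. C \<subseteq> carrier G \<and> \<one>\<^bsub>G\<^esub> \<in> C) \<and>
     (\<forall>C\<in>\<pi>. \<forall>D\<in>\<pi>. C \<approx> D) \<and>
     (\<forall>C\<in>\<pi>. \<forall>D\<in>\<pi>. C \<noteq> D \<longrightarrow> C \<inter> D = {\<one>\<^bsub>G\<^esub>}) \<and>
     T_axiom G \<pi>"

text \<open>
  The blocks form a set of subsets: \<open>gC\<close> and \<open>hD\<close> give the same vertex whenever they are equal
  as sets. The sum type keeps the two parts disjoint.
\<close>
definition bcay :: "('a, 'm) monoid_scheme \<Rightarrow> 'a set set \<Rightarrow> ('a + 'a set) pair_pre_digraph" where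
  "bcay G \<pi> = mk_symmetric
     \<lparr> pverts = carrier G <+> {g <#\<^bsub>G\<^esub> C | g C. g \<in> carrier G \<and> C \<in> \<pi>},
       parcs = {(Inl g, Inr (g <#\<^bsub>G\<^esub> C)) | g C. g \<in> carrier G \<and> C \<in> \<pi>} \<rparr>"

end

theory Submission
  imports Defs
begin

text \<open>
  Two elements \<open>x \<noteq> x'\<close> of \<open>S\<close> with \<open>h x, h x' \<in> S\<close> for some \<open>h \<noteq> \<one>\<close> would yield the 4-cycle
  \<open>(\<one>, 0), (h x, 1), (h, 0), (h x', 1)\<close>. So girth at least six forces \<open>S\<close> and \<open>h S\<close> to share
  at most one element; since \<open>C\<^sub>i = s\<^sub>i\<inverse> S\<close>, this gives the conditions on \<open>\<pi>\<close>. The blocks of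
  \<open>BCay(G, \<pi>)\<close> are exactly the translates \<open>g S\<close>, and the isomorphism exchanges the two parts:
  it sends \<open>(g, 0)\<close> to the block \<open>g S\<close> and \<open>(g, 1)\<close> to the point \<open>g\<close>.
\<close>

text \<open>An arc is a pair of vertices, so a vertex map \<open>f\<close> dictates its arc map
  \<open>map_prod f f\<close>. Since all arcs join vertices, injectivity of \<open>f\<close> on
  vertices passes to the arcs.\<close>

lemma digraph_iso_with_projI:
  assumes "inj_on f (pverts X)" and "parcs X \<subseteq> pverts X \<times> pverts X"
    and "pverts Y = f ` pverts X" and "parcs Y = map_prod f f ` parcs X"
  shows "digraph_iso (with_proj X) (with_proj Y)"
proof -
  let ?hom = "\<lparr>iso_verts = f, iso_arcs = map_prod f f, iso_head = snd, iso_tail = fst\<rparr>"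
  have "inj_on (map_prod f f) (parcs X)"
    using map_prod_inj_on[OF assms(1,1)] assms(2) by (rule inj_on_subset)
  moreover have "wf_digraph (with_proj X)"
    using assms(2) by unfold_locales auto
  ultimately have "pre_digraph.digraph_isomorphism (with_proj X) ?hom"
    using assms(1) by (simp add: pre_digraph.digraph_isomorphism_def)
  moreover have "with_proj Y = app_iso ?hom (with_proj X)"
    using assms(3,4) by (simp add: app_iso_def with_proj_def)
  ultimately show ?thesis
    unfolding digraph_iso_def by blast
qed

lemma girth_le_4:
  assumes "distinct [a, b, c, d]" and "a \<in> pverts X"
    and "{(a, b), (b, c), (c, d), (d, a)} \<subseteq> parcs X"
  shows "girth X \<le> 4"
proof -
  let ?p = "[(a, b), (b, c), (c, d), (d, a)]"
  have "pre_digraph.cycle (with_proj X) ?p"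
    using assms
    by (auto simp: pre_digraph.cycle_def pre_digraph.awalk_def pre_digraph.cas.simps
        pre_digraph.awalk_verts.simps intro!: exI[of _ a])
  then have "girth X \<le> enat (length ?p)"
    unfolding girth_def by (intro INF_lower) simp
  then show ?thesis
    by (simp add: numeral_eq_enat eval_nat_numeral)
qed

lemma pverts_bicay: "pverts (bicay G S) = carrier G \<times> {0, 1}"
  by (simp add: bicay_def)

text \<open>Indexed unions replace set comprehensions so that \<open>image_UN\<close> can later push
  a vertex map through the arc set.\<close>

lemma parcs_bicay:
  "parcs (bicay G S) =
    (\<Union>g\<in>carrier G. \<Union>s\<in>S. {((g, 0), (g \<otimes>\<^bsub>G\<^esub> s, 1)), ((g \<otimes>\<^bsub>G\<^esub> s, 1), (g, 0))})"
  by (auto simp: bicay_def parcs_mk_symmetric)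

lemma pverts_bcay:
  "pverts (bcay G \<pi>) = carrier G <+> (\<Union>g\<in>carrier G. \<Union>C\<in>\<pi>. {g <#\<^bsub>G\<^esub> C})"
  by (auto simp: bcay_def)

lemma parcs_bcay:
  "parcs (bcay G \<pi>) = (\<Union>g\<in>carrier G. \<Union>C\<in>\<pi>.
    {(Inl g, Inr (g <#\<^bsub>G\<^esub> C)), (Inr (g <#\<^bsub>G\<^esub> C), Inl g)})"
  unfolding bcay_def parcs_mk_symmetric by auto blast

context group
begin

text \<open>This turns the girth bound into algebra: both the trivial stabiliser of \<open>S\<close>
  and the intersections of blocks are derived from it.\<close>

lemma bicay_translate_eq_one:
  assumes "4 < girth (bicay G S)" and "S \<subseteq> carrier G" and "h \<in> carrier G"
    and "x \<in> S" "x' \<in> S" "h \<otimes> x \<in> S" "h \<otimes> x' \<in> S" and "x \<noteq> x'"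
  shows "h = \<one>"
proof (rule ccontr)
  assume "h \<noteq> \<one>"
  have carr: "x \<in> carrier G" "x' \<in> carrier G" "h \<otimes> x \<in> carrier G" "h \<otimes> x' \<in> carrier G"
    using assms by auto
  have arc: "((g, 0), (g \<otimes> s, 1)) \<in> parcs (bicay G S)"
    "((g \<otimes> s, 1), (g, 0)) \<in> parcs (bicay G S)" if "g \<in> carrier G" "s \<in> S" for g s
    using that by (auto simp: parcs_bicay)
  have "girth (bicay G S) \<le> 4"
  proof (rule girth_le_4)
    show "distinct [(\<one>, 0::nat), (h \<otimes> x, 1), (h, 0), (h \<otimes> x', 1)]"
      using \<open>h \<noteq> \<one>\<close> assms carr by auto
    show "(\<one>, 0) \<in> pverts (bicay G S)"
      by (simp add: pverts_bicay)
    \<comment> \<open>The vertex \<open>(h \<otimes> x, 1)\<close> is joined to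
      \<open>(\<one>, 0)\<close> through the element \<open>h \<otimes> x\<close> of
      \<open>S\<close> and to \<open>(h, 0)\<close> through \<open>x\<close>; likewise for
      \<open>x'\<close>.\<close>
    show "{((\<one>, 0), (h \<otimes> x, 1)), ((h \<otimes> x, 1), (h, 0)), ((h, 0), (h \<otimes> x', 1)),
        ((h \<otimes> x', 1), (\<one>, 0))} \<subseteq> parcs (bicay G S)"
      using arc[of \<one> "h \<otimes> x"] arc[of \<one> "h \<otimes> x'"] arc[of h x] arc[of h x'] assms carr by simp
  qed
  with assms(1) show False by simp
qed

lemma l_coset_l_coset:
  assumes "g \<in> carrier G" "h \<in> carrier G" "S \<subseteq> carrier G"
  shows "g <# (h <# S) = (g \<otimes> h) <# S"
  using assms by (force simp: l_coset_def m_assoc)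

lemma l_coset_eqpoll:
  assumes "g \<in> carrier G" "S \<subseteq> carrier G"
  shows "g <# S \<approx> S"
proof -
  have "inj_on ((\<otimes>) g) S"
    using assms by (auto simp: inj_on_def subset_iff)
  moreover have "(\<otimes>) g ` S = g <# S"
    by (auto simp: l_coset_def)
  ultimately show ?thesis
    by (metis inj_on_image_eqpoll_self)
qed

text \<open>If \<open>g\<close> and \<open>k\<close> give the same translate, then
  \<open>inv k \<otimes> g\<close> stabilises \<open>S\<close>; the point is that this stabiliser is
  trivial.\<close>

lemma inj_on_l_coset:
  assumes "4 < girth (bicay G S)" and "S \<subseteq> carrier G" and "S \<noteq> {}"
  shows "inj_on (\<lambda>g. g <# S) (carrier G)"
proof (rule inj_onI)
  fix g k assume g: "g \<in> carrier G" and k: "k \<in> carrier G" and eq: "g <# S = k <# S"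
  define h where "h = inv k \<otimes> g"
  have h: "h \<in> carrier G" using g k by (simp add: h_def)
  have "h <# S = inv k <# (g <# S)"
    using g k assms(2) by (simp add: l_coset_l_coset h_def)
  also have "\<dots> = S"
    using k assms(2) by (simp add: eq l_coset_l_coset lcos_mult_one)
  finally have hS: "h <# S = S" .
  then have mem: "h \<otimes> y \<in> S" if "y \<in> S" for y
    using that by (auto simp: l_coset_def)
  obtain x where x: "x \<in> S" using assms(3) by blast
  have "h = \<one>"
  \<comment> \<open>A fixed point gives \<open>h = \<one>\<close> by cancellation, which covers a
    singleton \<open>S\<close>. Otherwise \<open>x\<close> and \<open>h \<otimes> x\<close> are two
    distinct elements of \<open>S\<close> that \<open>h\<close> sends back into
    \<open>S\<close>.\<close>
  proof (cases "h \<otimes> x = x")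
    case True
    then show ?thesis using h x assms(2) by auto
  next
    case False
    then show ?thesis
      using bicay_translate_eq_one[OF assms(1,2) h x] mem x by metis
  qed
  then show "g = k"
    using g k by (metis h_def inv_equality inv_inv inv_closed)
qed

end

theorem theorem9p8:
  fixes G :: "('a, 'm) monoid_scheme" (structure)
    and S :: "'a set" and s :: "nat \<Rightarrow> 'a" and l :: nat
    and C :: "nat \<Rightarrow> 'a set" and \<pi> :: "'a set set"
  assumes "group G"
    and "S \<subseteq> carrier G"
    and "1 \<le> l"
    and "inj_on s {1..l}"
    and "S = s ` {1..l}"
    and "6 \<le> girth (bicay G S)"
    and "\<And>i. i \<in> {1..l} \<Longrightarrow> C i = {inv (s i) \<otimes> s j | j. j \<in> {1..l}}"
    and "\<pi> = C ` {1..l}"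
  shows "inj_on C {1..l} \<and> cayley_incidence_family G \<pi> \<and>
    digraph_iso (with_proj (bicay G S)) (with_proj (bcay G \<pi>))"
proof -
  interpret group G by fact
  have girth: "4 < girth (bicay G S)"
    by (rule less_le_trans[OF _ assms(6)]) simp
  have S: "S \<noteq> {}"
    using assms(3,5) by auto
  have carr: "t \<in> carrier G" if "t \<in> S" for t
    using that assms(2) by blast
  have s_S: "s i \<in> S" if "i \<in> {1..l}" for i
    using that assms(5) by blast
  have C: "C i = inv (s i) <# S" if "i \<in> {1..l}" for i
    using assms(7)[OF that] by (auto simp: l_coset_def assms(5))
  \<comment> \<open>From here on the blocks are indexed by the elements \<open>t\<close> of
    \<open>S\<close> instead of by their positions.\<close>
  have \<pi>: "\<pi> = (\<lambda>t. inv t <# S) ` S"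
    using C by (auto simp: assms(8) assms(5))
  have cancel: "t \<otimes> (inv t \<otimes> a) = a" "a \<otimes> t \<otimes> inv t = a"
    "a \<otimes> inv t \<otimes> t = a"
    if "t \<in> carrier G" "a \<in> carrier G" for t a
    using that by (simp_all add: m_assoc[symmetric]) (simp_all add: m_assoc)
  have inter: "x = \<one>" if t: "t \<in> S" "u \<in> S" "t \<noteq> u"
    and x: "x \<in> inv t <# S" "x \<in> inv u <# S" for t u x
  proof -
    obtain a b where a: "a \<in> S" "x = inv t \<otimes> a" and b: "b \<in> S" "x = inv u \<otimes> b"
      using x by (auto simp: l_coset_def)
    have G: "t \<in> carrier G" "u \<in> carrier G" "a \<in> carrier G" "b \<in> carrier G"
      using t a b carr by auto
    \<comment> \<open>As \<open>inv t \<otimes> a = inv u \<otimes> b\<close>, left translation by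
      \<open>h\<close> sends \<open>t\<close> to \<open>u\<close> and also \<open>a\<close> to
      \<open>b\<close>. It is not the identity, so \<open>t\<close> and \<open>a\<close> must
      coincide, and then \<open>x = inv t \<otimes> a\<close> is \<open>\<one>\<close>.\<close>
    define h where "h = u \<otimes> inv t"
    have h: "h \<in> carrier G" using G by (simp add: h_def)
    have ht: "h \<otimes> t = u" using G by (simp add: h_def cancel)
    have "h \<otimes> a = u \<otimes> (inv u \<otimes> b)" using G a b by (simp add: h_def m_assoc)
    then have ha: "h \<otimes> a = b" using G by (simp add: cancel)
    have "h \<noteq> \<one>" using ht t G by auto
    then have "t = a"
      using bicay_translate_eq_one[OF girth assms(2) h, of t a] t a b ht ha by auto
    then show ?thesis using a G by simp
  qed
  have inv_S_inj: "t = u" if t: "t \<in> S" "u \<in> S" and eq: "inv t <# S = inv u <# S" for t u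
    using inj_onD[OF inj_on_l_coset[OF girth assms(2) S] eq] t carr
    by (metis inv_closed inv_inv)
  have "inj_on C {1..l}"
  proof (rule inj_onI)
    fix i j assume ij: "i \<in> {1..l}" "j \<in> {1..l}" "C i = C j"
    then have "s i = s j" using inv_S_inj s_S C by metis
    then show "i = j" using ij assms(4) by (simp add: inj_on_eq_iff)
  qed
  moreover have "cayley_incidence_family G \<pi>"
  proof -
    have sub: "inv t <# S \<subseteq> carrier G" if "t \<in> S" for t
      using that carr by (auto simp: l_coset_def)
    have one: "\<one> \<in> inv t <# S" if "t \<in> S" for t
      using that carr l_inv by (force simp: l_coset_def)
    have eqp: "inv t <# S \<approx> inv u <# S" if "t \<in> S" "u \<in> S" for t u
      using that carr assms(2) l_coset_eqpoll eqpoll_sym eqpoll_trans by (metis inv_closed)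
    have T: "inv x <# (inv t <# S) \<in> \<pi>" if tx: "t \<in> S" "x \<in> inv t <# S" for t x
    proof -
      obtain a where a: "a \<in> S" "x = inv t \<otimes> a"
        using tx by (auto simp: l_coset_def)
      \<comment> \<open>Here \<open>inv x \<otimes> inv t = inv a \<otimes> t \<otimes> inv t = inv
        a\<close>.\<close>
      then have "inv x <# (inv t <# S) = inv a <# S"
        using tx carr assms(2) by (simp add: l_coset_l_coset inv_mult_group cancel)
      then show ?thesis using a \<pi> by blast
    qed
    have int: "(inv t <# S) \<inter> (inv u <# S) = {\<one>}"
      if "t \<in> S" "u \<in> S" "inv t <# S \<noteq> inv u <# S" for t u
      using inter[of t u] one that by blast
    show ?thesis
      unfolding cayley_incidence_family_def T_axiom_def
      using sub one eqp T int by (simp add: \<pi>)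
  qed
  moreover have "digraph_iso (with_proj (bicay G S)) (with_proj (bcay G \<pi>))"
  proof -
    \<comment> \<open>The neighbours of \<open>(g, 0)\<close> are the
      \<open>(g \<otimes> t, 1)\<close> with \<open>t\<close> in \<open>S\<close>, so the block
      assigned to it is the set of points assigned to its neighbours. On vertices the
      \<open>else\<close> branch means \<open>k = 1\<close>.\<close>
    define f :: "'a \<times> nat \<Rightarrow> 'a + 'a set"
      where "f = (\<lambda>(g, k). if k = 0 then Inr (g <# S) else Inl g)"
    have f: "f (g, 0) = Inr (g <# S)" "f (g, 1) = Inl g" for g
      by (simp_all add: f_def)
    have block: "g <# (inv t <# S) = (g \<otimes> inv t) <# S" if "g \<in> carrier G" "t \<in> S" for g t
      using that carr assms(2) by (simp add: l_coset_l_coset)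
    have block': "g <# S = (g \<otimes> t) <# (inv t <# S)" if "g \<in> carrier G" "t \<in> S" for g t
      using that carr by (simp add: block cancel)
    have surj: "(\<Union>g\<in>carrier G. \<Union>D\<in>\<pi>. {g <# D}) = (\<lambda>g. g <# S) ` carrier G"
    proof (intro equalityI subsetI)
      fix B assume "B \<in> (\<Union>g\<in>carrier G. \<Union>D\<in>\<pi>. {g <# D})"
      then show "B \<in> (\<lambda>g. g <# S) ` carrier G"
        using carr by (auto simp: \<pi> block)
    next
      fix B assume "B \<in> (\<lambda>g. g <# S) ` carrier G"
      then obtain g where g: "g \<in> carrier G" "B = g <# S" by blast
      \<comment> \<open>Any element of \<open>S\<close> serves, since \<open>t\<close> and
        \<open>inv t\<close> cancel in \<open>(g \<otimes> t) <# (inv t <# S)\<close>.\<close>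
      obtain t where t: "t \<in> S" using S by blast
      have "B = (g \<otimes> t) <# (inv t <# S)" using g t block' by simp
      then show "B \<in> (\<Union>g\<in>carrier G. \<Union>D\<in>\<pi>. {g <# D})"
        using g t carr \<pi> by blast
    qed
    show ?thesis
    proof (rule digraph_iso_with_projI)
      show "inj_on f (pverts (bicay G S))"
        using inj_on_l_coset[OF girth assms(2) S]
        by (auto simp: inj_on_def f_def pverts_bicay)
      show "parcs (bicay G S) \<subseteq> pverts (bicay G S) \<times> pverts (bicay G S)"
        using carr by (auto simp: parcs_bicay pverts_bicay)
      have "f ` pverts (bicay G S) = Inl ` carrier G \<union> Inr ` (\<lambda>g. g <# S) ` carrier G"
        by (auto simp: pverts_bicay f_def image_iff)
      then show "pverts (bcay G \<pi>) = f ` pverts (bicay G S)"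
        by (simp add: pverts_bcay surj Plus_def)
      have "map_prod f f ` parcs (bicay G S) = (\<Union>g\<in>carrier G. \<Union>t\<in>S.
          {(Inr (g <# S), Inl (g \<otimes> t)), (Inl (g \<otimes> t), Inr (g <# S))})"
        by (simp add: parcs_bicay image_UN f del: One_nat_def)
      \<comment> \<open>For fixed \<open>t\<close>, right multiplication by \<open>t\<close>
        permutes the group: the index \<open>(g, t)\<close> on the left yields the same arcs as
        \<open>(g \<otimes> t, t)\<close> on the right.\<close>
      also have "\<dots> = (\<Union>g\<in>carrier G. \<Union>t\<in>S.
          {(Inl g, Inr (g <# (inv t <# S))), (Inr (g <# (inv t <# S)), Inl g)})"
          (is "?L = ?R")
      proof
        show "?L \<subseteq> ?R"
        proof (intro UN_least)
          fix g t assume gt: "g \<in> carrier G" "t \<in> S"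
          then have "g \<otimes> t \<in> carrier G" using carr by simp
          then show "{(Inr (g <# S), Inl (g \<otimes> t)), (Inl (g \<otimes> t), Inr (g <# S))} \<subseteq> ?R"
            using gt block'[OF gt] by blast
        qed
        show "?R \<subseteq> ?L"
        proof (intro UN_least)
          fix g t assume gt: "g \<in> carrier G" "t \<in> S"
          then have "g \<otimes> inv t \<in> carrier G" "g = g \<otimes> inv t \<otimes> t"
            using carr by (simp_all add: cancel)
          then show "{(Inl g, Inr (g <# (inv t <# S))), (Inr (g <# (inv t <# S)), Inl g)} \<subseteq> ?L"
            using gt block[OF gt] by blast
        qed
      qed
      finally show "parcs (bcay G \<pi>) = map_prod f f ` parcs (bicay G S)"
        by (simp add: parcs_bcay \<pi>)
    qed
  qed
  ultimately show ?thesis by blast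
qed

end
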